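(* Suppose there are constants $A,C>0$ such that, for every even $n\ge 6$, $t_{\min}(n)$ is defined and satisfies $t_{\min}(n)\le C\log^A n$. Then $$\pi_{\mathcal T}(z)\;\gg_{A,C}\; z^{1/A},$$ i.e. there are constants $\kappa>0$ and $z_1$ depending only on $A$ and $C$ such that $\pi_{\mathcal T}(z)\ge\kappa z^{1/A}$ for all real $z\ge z_1$. In particular $\mathcal T$ is infinite, so any such bound implies the twin prime conjecture, with a power-of-$z$ lower bound on the number of twin members.
   Context: A prime $t$ is a twin member if $t-2$ or $t+2$ is prime; $\mathcal T$ denotes the set of all twin members, and $\pi_{\mathcal T}(z)=\#\{t\in\mathcal T:t\le z\}$. For an even integer $n$, $t_{\min}(n)=\min\{t\in\mathcal T: n-t\text{ is prime}\}$, defined whenever this set is nonempty. $\log^A n$ means $(\log n)^A$ with the natural logarithm. *)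

theory Defs
  imports Complex_Main "HOL-Computational_Algebra.Primes"
begin

text \<open>Truncated subtraction is harmless below: a prime \<open>t\<close> is at least 2, and
  \<open>n - t\<close> is 0, hence not prime, whenever \<open>t \<ge> n\<close>.\<close>

definition twin_member :: "nat \<Rightarrow> bool" where
  "twin_member t \<longleftrightarrow> prime t \<and> (prime (t - 2) \<or> prime (t + 2))"

definition twin_members :: "nat set" where
  "twin_members = {t. twin_member t}"

definition pi_twin :: "real \<Rightarrow> nat" where
  "pi_twin z = card {t \<in> twin_members. real t \<le> z}"

definition twin_summands :: "nat \<Rightarrow> nat set" where
  "twin_summands n = {t \<in> twin_members. prime (n - t)}"

text \<open>Meaningful only if \<open>twin_summands n\<close> is nonempty.\<close>

definition t_min :: "nat \<Rightarrow> nat" where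
  "t_min n = (LEAST t. t \<in> twin_summands n)"

definition t_min_bound :: "real \<Rightarrow> real \<Rightarrow> bool" where
  "t_min_bound A C \<longleftrightarrow>
     (\<forall>n\<ge>6. even n \<longrightarrow>
        twin_summands n \<noteq> {} \<and> real (t_min n) \<le> C * ln (real n) powr A)"

end

theory Submission
  imports Defs "HOL-Number_Theory.Cong"
begin

text \<open>
  The proof is a count of sums. Suppose every even \<open>n \<ge> 6\<close> is a twin member
  \<open>t \<le> C * ln n powr A\<close> plus a prime, and let \<open>k \<le> (z / C) powr (1 / A)\<close>. Then each even
  number from 6 to \<open>2 ^ k\<close> is such a sum with \<open>t \<le> z\<close>. There are about \<open>2 ^ k / 2\<close> of these
  numbers, but only \<open>pi_twin z\<close> choices for \<open>t\<close> and, by Chebyshev's upper bound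
  (\<open>card_primes_upto_power_two\<close>), only \<open>O(2 ^ k / k)\<close> choices for the prime. Hence
  \<open>pi_twin z\<close> is at least a constant times \<open>k\<close> (\<open>pi_twin_lower_bound\<close>), and the largest
  admissible \<open>k\<close> has the order of \<open>z powr (1 / A)\<close>.

  Using powers of two as cut-off points keeps both the Chebyshev estimate and the count in the
  natural numbers: the only analysis left is the comparison of \<open>k\<close> with \<open>z\<close>.
\<close>

text \<open>A prime in \<open>{m<..2 * m}\<close> divides the numerator of
  \<open>2 * m choose m = fact (2 * m) / (fact m * fact m)\<close> but not its denominator. Since the
  binomial coefficient is at most \<open>2 ^ (2 * m)\<close>, there cannot be many such primes.\<close>

lemma power_card_primes_between_le:
  fixes m :: nat
  shows "m ^ card {p. prime p \<and> m < p \<and> p \<le> 2 * m} \<le> 2 ^ (2 * m)"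
proof -
  let ?P = "{p. prime p \<and> m < p \<and> p \<le> 2 * m}"
  have dvd: "p dvd (2 * m choose m)" if "p \<in> ?P" for p
  proof -
    have p: "prime p" "m < p" "p \<le> 2 * m" using that by auto
    have "p dvd (fact (2 * m) :: nat)" using p by (simp add: prime_dvd_fact_iff)
    also have "fact (2 * m) = fact m * fact m * (2 * m choose m)"
      using binomial_fact_lemma[of m "2 * m"] by (simp add: mult_2)
    finally show ?thesis
      using p by (simp add: prime_dvd_mult_iff prime_dvd_fact_iff)
  qed
  have "[(2 * m choose m) = 0] (mod (\<Prod>p\<in>?P. p))"
    using dvd by (intro cong_cong_prod_coprime_nat) (auto simp: cong_0_iff primes_coprime)
  then have "(\<Prod>p\<in>?P. p) dvd (2 * m choose m)" by (simp add: cong_0_iff)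
  then have "(\<Prod>p\<in>?P. p) \<le> (2 * m choose m)"
    by (rule dvd_imp_le) simp
  moreover have "(\<Prod>p\<in>?P. m) \<le> (\<Prod>p\<in>?P. p)" by (rule prod_mono) auto
  moreover have "(2 * m choose m) \<le> 2 ^ (2 * m)" by (rule binomial_le_pow2)
  ultimately show ?thesis by simp
qed

lemma card_primes_between_powers_of_two:
  "k * card {p :: nat. prime p \<and> 2 ^ k < p \<and> p \<le> 2 ^ Suc k} \<le> 2 ^ Suc k"
proof -
  have "(2::nat) ^ (k * card {p :: nat. prime p \<and> 2 ^ k < p \<and> p \<le> 2 ^ Suc k}) \<le> 2 ^ (2 ^ Suc k)"
    using power_card_primes_between_le[of "2 ^ k"] by (simp add: power_mult)
  then show ?thesis by (rule power_le_imp_le_exp[rotated]) simp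
qed

text \<open>Induction over the dyadic blocks. Passing from \<open>k\<close> to \<open>k + 1\<close>, the new block adds
  \<open>2 * 2 ^ k\<close>, the old primes contribute \<open>4 * 2 ^ k\<close>, and the increase of the factor \<open>k\<close> costs
  one more copy of the prime count, for which the trivial bound \<open>2 * 2 ^ k\<close> is enough. The
  constant 4 is the least one for which these three add up to its double.\<close>

lemma card_primes_upto_power_two:
  "k * card {p :: nat. prime p \<and> p \<le> 2 ^ k} \<le> 4 * 2 ^ k"
proof (induction k)
  case 0
  show ?case by simp
next
  case (Suc k)
  let ?old = "{p :: nat. prime p \<and> p \<le> 2 ^ k}"
  let ?block = "{p :: nat. prime p \<and> 2 ^ k < p \<and> p \<le> 2 ^ Suc k}"
  let ?all = "{p :: nat. prime p \<and> p \<le> 2 ^ Suc k}"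
  have "?all \<subseteq> ?old \<union> ?block" by auto
  moreover have "finite ?old" "finite ?block"
    by (rule finite_subset[of _ "{..2 ^ Suc k}"]; auto)+
  ultimately have split: "card ?all \<le> card ?old + card ?block"
    by (meson card_Un_le card_mono finite_UnI le_trans)
  have "?all \<subseteq> {1..2 ^ Suc k}" by (auto simp: Suc_le_eq prime_gt_0_nat simp del: power_Suc)
  then have trivial: "card ?all \<le> 2 ^ Suc k"
    using card_mono[of "{1..2 ^ Suc k}" ?all] by simp
  have "Suc k * card ?all = k * card ?all + card ?all" by simp
  also have "k * card ?all \<le> k * card ?old + k * card ?block"
    using mult_le_mono2[OF split, of k] by (simp only: distrib_left)
  also have "k * card ?block \<le> 2 ^ Suc k" by (rule card_primes_between_powers_of_two)
  finally show ?case using Suc.IH trivial by simp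
qed

lemma finite_twin_members_le: "finite {t \<in> twin_members. real t \<le> z}"
  by (rule finite_subset[of _ "{..nat \<lfloor>z\<rfloor>}"]) (auto simp: le_nat_floor)

lemma t_min_in_twin_summands:
  "twin_summands n \<noteq> {} \<Longrightarrow> t_min n \<in> twin_summands n"
  unfolding t_min_def by (metis LeastI_ex ex_in_conv)

text \<open>The map sending \<open>n\<close> to \<open>(t_min n, n - t_min n)\<close> is injective, because \<open>n\<close> is the sum of
  the two components.\<close>

lemma card_even_le_twins_times_primes:
  fixes N :: nat
  assumes "\<And>n. \<lbrakk>6 \<le> n; n \<le> N; even n\<rbrakk> \<Longrightarrow> twin_summands n \<noteq> {} \<and> real (t_min n) \<le> z"
  shows "card {n. 6 \<le> n \<and> n \<le> N \<and> even n} \<le> pi_twin z * card {p. prime p \<and> p \<le> N}"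
proof -
  let ?E = "{n. 6 \<le> n \<and> n \<le> N \<and> even n}"
  let ?T = "{t \<in> twin_members. real t \<le> z}"
  let ?P = "{p. prime p \<and> p \<le> N}"
  have summand: "t_min n \<in> twin_members \<and> prime (n - t_min n)" if "n \<in> ?E" for n
    using t_min_in_twin_summands[of n] assms[of n] that by (auto simp: twin_summands_def)
  have sum: "t_min n + (n - t_min n) = n" if "n \<in> ?E" for n
    using summand[OF that] prime_gt_0_nat[of "n - t_min n"] by simp
  have "inj_on (\<lambda>n. (t_min n, n - t_min n)) ?E"
    by (rule inj_onI) (metis sum prod.inject)
  moreover have "(\<lambda>n. (t_min n, n - t_min n)) ` ?E \<subseteq> ?T \<times> ?P"
    using summand assms by auto
  moreover have "finite (?T \<times> ?P)"
    using finite_twin_members_le by (intro finite_cartesian_product) auto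
  ultimately have "card ?E \<le> card (?T \<times> ?P)" by (rule card_inj_on_le)
  then show ?thesis by (simp add: card_cartesian_product pi_twin_def)
qed

text \<open>The count is \<open>2 ^ (k - 1) - 2\<close>. For \<open>k \<ge> 3\<close> the subtracted 2, which stands for the even
  numbers 2 and 4, is at most half of \<open>2 ^ (k - 1)\<close>.\<close>

lemma card_even_upto_power_two:
  assumes "3 \<le> k"
  shows "2 ^ k \<le> 4 * card {n :: nat. 6 \<le> n \<and> n \<le> 2 ^ k \<and> even n}"
proof -
  obtain j where k: "k = j + 3" using assms by (metis le_add_diff_inverse2)
  have "(\<lambda>i. 2 * i) ` {3..4 * 2 ^ j} \<subseteq> {n :: nat. 6 \<le> n \<and> n \<le> 2 ^ k \<and> even n}"
    by (auto simp: k power_add)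
  moreover have "inj_on (\<lambda>i. 2 * i) {3..4 * 2 ^ j :: nat}" by (simp add: inj_on_def)
  ultimately have "card {3..4 * 2 ^ j :: nat} \<le> card {n :: nat. 6 \<le> n \<and> n \<le> 2 ^ k \<and> even n}"
    by (intro card_inj_on_le) auto
  then have "4 * 2 ^ j - 2 \<le> card {n :: nat. 6 \<le> n \<and> n \<le> 2 ^ k \<and> even n}" by simp
  moreover have "(1::nat) \<le> 2 ^ j" by simp
  moreover have "(2::nat) ^ k = 8 * 2 ^ j" by (simp add: k power_add)
  ultimately show ?thesis by linarith
qed

lemma exponent_le_pi_twin:
  assumes "3 \<le> k"
    and "\<And>n. \<lbrakk>6 \<le> n; n \<le> 2 ^ k; even n\<rbrakk> \<Longrightarrow> twin_summands n \<noteq> {} \<and> real (t_min n) \<le> z"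
  shows "k \<le> 16 * pi_twin z"
proof -
  let ?E = "{n :: nat. 6 \<le> n \<and> n \<le> 2 ^ k \<and> even n}"
  let ?P = "{p :: nat. prime p \<and> p \<le> 2 ^ k}"
  have "k * 2 ^ k \<le> k * (4 * card ?E)"
    using card_even_upto_power_two[OF assms(1)] by (rule mult_le_mono2)
  also have "\<dots> \<le> k * (4 * (pi_twin z * card ?P))"
    using card_even_le_twins_times_primes[OF assms(2)] by (intro mult_le_mono2)
  also have "\<dots> = 4 * pi_twin z * (k * card ?P)" by simp
  also have "\<dots> \<le> 4 * pi_twin z * (4 * 2 ^ k)"
    using card_primes_upto_power_two by (rule mult_le_mono2)
  finally show ?thesis by simp
qed

text \<open>The constant 32 is the 16 of \<open>exponent_le_pi_twin\<close> times a factor 2, which pays for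
  rounding \<open>(z / C) powr (1 / A)\<close> down to an integer. The threshold for \<open>z\<close> makes that
  integer at least 3.\<close>

lemma pi_twin_lower_bound:
  assumes "A > 0" "C > 0" and bound: "t_min_bound A C" and z: "z \<ge> C * 3 powr A"
  shows "real (pi_twin z) \<ge> (1 / C) powr (1 / A) / 32 * z powr (1 / A)"
proof -
  define x where "x = (z / C) powr (1 / A)"
  define k where "k = nat \<lfloor>x\<rfloor>"
  have "0 < C * 3 powr A" using assms by simp
  then have z_pos: "z > 0" using z by linarith
  have "(3 powr A) powr (1 / A) \<le> x"
    unfolding x_def using assms by (intro powr_mono2) (auto simp: field_simps)
  then have x3: "3 \<le> x" using assms by (simp add: powr_powr)
  have k: "real k \<le> x" "x < real k + 1" "3 \<le> k"
    using x3 of_nat_floor[of x] floor_correct[of x]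
    by (simp_all add: k_def le_nat_floor)
  have x_powr: "x powr A = z / C" using assms z_pos by (simp add: x_def powr_powr)
  have "k \<le> 16 * pi_twin z"
  proof (rule exponent_le_pi_twin[OF k(3)])
    fix n :: nat
    assume n: "6 \<le> n" "n \<le> 2 ^ k" "even n"
    have "real n \<le> 2 ^ k" using n(2) by (metis of_nat_le_iff of_nat_numeral of_nat_power)
    then have "ln (real n) \<le> ln (2 ^ k)" using n(1) by simp
    also have "\<dots> = real k * ln 2" by (simp add: ln_realpow)
    also have "\<dots> \<le> real k * 1" using ln_2_less_1 by (intro mult_left_mono) auto
    finally have "ln (real n) \<le> x" using k by simp
    then have "ln (real n) powr A \<le> z / C"
      using n assms unfolding x_powr[symmetric] by (intro powr_mono2) auto
    then have "C * ln (real n) powr A \<le> z" using assms by (simp add: field_simps)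
    then show "twin_summands n \<noteq> {} \<and> real (t_min n) \<le> z"
      using bound n by (force simp: t_min_bound_def)
  qed
  then have "x \<le> 32 * real (pi_twin z)" using k by linarith
  moreover have "x = (1 / C) powr (1 / A) * z powr (1 / A)"
    using assms z_pos by (simp add: x_def powr_divide)
  ultimately show ?thesis by simp
qed

lemma infinite_twin_members_if_lower_bound:
  assumes "A > 0" "\<kappa> > 0"
    and lower: "\<And>z. z \<ge> z\<^sub>1 \<Longrightarrow> real (pi_twin z) \<ge> \<kappa> * z powr (1 / A)"
  shows "infinite twin_members"
proof
  assume fin: "finite twin_members"
  define y where "y = (real (card twin_members) + 1) / \<kappa>"
  \<comment> \<open>Beyond \<open>y powr A\<close> the lower bound exceeds the total number of twin members.\<close>
  define z where "z = max z\<^sub>1 (y powr A)"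
  have y: "y > 0" using assms by (simp add: y_def)
  have "y = (y powr A) powr (1 / A)" using y assms by (simp add: powr_powr)
  also have "\<dots> \<le> z powr (1 / A)" using assms by (intro powr_mono2) (auto simp: z_def)
  finally have "\<kappa> * y \<le> \<kappa> * z powr (1 / A)" using assms by (intro mult_left_mono) auto
  also have "\<dots> \<le> real (pi_twin z)" by (rule lower) (simp add: z_def)
  also have "\<dots> \<le> real (card twin_members)"
    unfolding pi_twin_def using fin by (auto intro: card_mono)
  finally show False using assms by (simp add: y_def)
qed

lemma infinite_twin_primes_if_infinite_twin_members:
  assumes "infinite twin_members"
  shows "infinite {p :: nat. prime p \<and> prime (p + 2)}"
proof
  let ?S = "{p :: nat. prime p \<and> prime (p + 2)}"
  assume "finite ?S"
  moreover have "twin_members \<subseteq> ?S \<union> (\<lambda>p. p + 2) ` ?S"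
  proof
    fix t assume "t \<in> twin_members"
    then have t: "prime t" "prime (t - 2) \<or> prime (t + 2)"
      by (auto simp: twin_members_def twin_member_def)
    show "t \<in> ?S \<union> (\<lambda>p. p + 2) ` ?S"
    proof (cases "prime (t + 2)")
      case True
      then show ?thesis using t by auto
    next
      case False
      then have "prime (t - 2)" using t by simp
      \<comment> \<open>Since 0 is not prime, the subtraction did not truncate.\<close>
      moreover from this have "t = (t - 2) + 2" using prime_gt_0_nat[of "t - 2"] by simp
      ultimately have "t - 2 \<in> ?S" using t by simp
      then show ?thesis using \<open>t = (t - 2) + 2\<close> by blast
    qed
  qed
  ultimately show False using assms by (meson finite_UnI finite_imageI finite_subset)
qed

theorem proposition2:
  fixes A C :: real
  assumes "A > 0" and "C > 0"
  shows "(\<exists>\<kappa>::real. \<kappa> > 0 \<and> (\<exists>z\<^sub>1::real. t_min_bound A C \<longrightarrow>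
            (\<forall>z::real. z \<ge> z\<^sub>1 \<longrightarrow> real (pi_twin z) \<ge> \<kappa> * z powr (1 / A)))) \<and>
         (t_min_bound A C \<longrightarrow>
            infinite twin_members \<and> infinite {p :: nat. prime p \<and> prime (p + 2)})"
proof -
  define \<kappa> where "\<kappa> = (1 / C) powr (1 / A) / 32"
  have \<kappa>: "\<kappa> > 0" using assms by (simp add: \<kappa>_def)
  have lower: "real (pi_twin z) \<ge> \<kappa> * z powr (1 / A)"
    if "t_min_bound A C" "z \<ge> C * 3 powr A" for z
    unfolding \<kappa>_def using pi_twin_lower_bound[OF assms that] .
  have "infinite twin_members" if "t_min_bound A C"
    using infinite_twin_members_if_lower_bound[OF assms(1) \<kappa>] lower[OF that] by blast
  then show ?thesis
    using \<kappa> lower infinite_twin_primes_if_infinite_twin_members by blast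
qed

end
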